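(* Let a body be a homogeneous sphere with mass $M>0$ and center $R=(x_0,y_0,z_0)$, $z_0>0$, lying below the surface plane $z=0$, and let $Q=(x_0,y_0,0)$ be the point at which the vertical intensity $V_z(\cdot,\cdot,0)$ of the body attains its maximum. Suppose that the coordinates $x_0,y_0$ of $Q$ are known, while the intensity $V_{zQ}=V_z(x_0,y_0,0)$ itself is not measured. Suppose that the intensity $V_{zP}=V_z(x,y,0)$ is measured at a point $P=(x,y,0)$ and the intensity $V_{zC}=V_z(x_c,y_c,0)$ is measured at a point $C=(x_c,y_c,0)$ closer to $Q$ than $P$. Put $$s=\sqrt{(x-x_0)^2+(y-y_0)^2},\qquad \Delta=\sqrt{(x_c-x_0)^2+(y_c-y_0)^2}\in[0,s),\qquad \nu=\frac{V_{zP}}{V_{zC}},\qquad \psi=\frac{\Delta}{s}.$$ Then the depth of the body is $$z_0=\mu s,\qquad\text{where}\quad \mu=\mu(\nu,\psi)=\sqrt{\frac{\nu^{2/3}-\psi^2}{1-\nu^{2/3}}},$$ and the mass of the body is $$M=\frac{1}{\gamma}\,\frac{(z_0^2+\Delta^2)^{3/2}}{z_0}\,V_{zC}.$$ Moreover, if $\Delta=0$ (so that $C=Q$), this turns into the following statement: with $\nu=V_{zP}/V_{zQ}$, one has $z_0=\mu s$ with $\mu=\mu(\nu)=\sqrt{\nu^{2/3}/(1-\nu^{2/3})}$, and $M=\frac{1}{\gamma}\frac{(z_0^2+s^2)^{3/2}}{z_0}V_{zP}$.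
   Context: Coordinates $(x,y,z)$ in $\mathbb{R}^3$: the plane $z=0$ is the Earth's surface and the $z$-axis is directed vertically downwards. $\gamma>0$ is the gravitational constant. A body occupying a bounded region $B$ in $\{z'>0\}$ with density $\rho$ produces at a surface point $(x,y,0)$ the vertical ($z$-)component of gravitational intensity $$V_z(x,y,0)=\gamma\int_B \frac{\rho\, z'}{\left((x-x')^2+(y-y')^2+z'^2\right)^{3/2}}\,dx'\,dy'\,dz'.$$ "Homogeneous sphere" means a solid ball of constant density $\rho>0$. Only one body is present, and the measured values of $V_z$ are taken to be the exact values produced by this body. The depth of the body is the $z$-coordinate $z_0$ of its center. *)

theory Defs
  imports "HOL-Analysis.Analysis"
begin

text \<open>Points of space are vectors \<open>p :: real^3\<close> with coordinates \<open>p$1\<close>, \<open>p$2\<close>, \<open>p$3\<close>; the Earth's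
  surface is the plane \<open>p$3 = 0\<close> and the third axis points downwards, so bodies lie in
  \<open>p$3 > 0\<close>. A body is given by its region \<open>B\<close> and its density \<open>\<rho>\<close>.\<close>

definition body_mass :: "(real^3) set \<Rightarrow> (real^3 \<Rightarrow> real) \<Rightarrow> real" where
  "body_mass B \<rho> = (LINT p:B|lborel. \<rho> p)"

text \<open>The vertical component of gravitational intensity at the surface point \<open>(x, y, 0)\<close>.\<close>

definition vertical_intensity ::
    "real \<Rightarrow> (real^3) set \<Rightarrow> (real^3 \<Rightarrow> real) \<Rightarrow> real \<Rightarrow> real \<Rightarrow> real" where
  "vertical_intensity \<gamma> B \<rho> x y =
     \<gamma> * (LINT p:B|lborel. \<rho> p * p$3 / ((x - p$1)\<^sup>2 + (y - p$2)\<^sup>2 + (p$3)\<^sup>2) powr (3/2))"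

end

theory Submission imports Defs begin

text \<open>
The formulas are algebra once Newton's theorem is known: seen from outside, a homogeneous ball
attracts as if its mass \<open>M\<close> sat at its centre. Hence at horizontal distance \<open>d\<close> from \<open>Q\<close> the
vertical intensity is \<open>\<gamma> * M * z\<^sub>0 / (z\<^sub>0\<^sup>2 + d\<^sup>2) powr (3/2)\<close>. It decreases strictly
in \<open>d\<close>, so \<open>Q\<close> is the unique maximum; and the \<open>2/3\<close> power of the ratio of the intensities at the
distances \<open>s\<close> and \<open>\<Delta>\<close> is \<open>(z\<^sub>0\<^sup>2 + \<Delta>\<^sup>2) / (z\<^sub>0\<^sup>2 + s\<^sup>2)\<close>, from which \<open>\<gamma>\<close> and \<open>M\<close> have cancelled
and which can be solved for \<open>z\<^sub>0\<close> (\<open>depth_from_intensity_ratio\<close>).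

Newton's theorem (\<open>newtonian_attraction_cball\<close>) is the mean value property of the components of
the inverse-square field, which are harmonic away from the attracted point. The mean value
property over solid balls (\<open>harmonic_mean_value_cball\<close>) is obtained without surface integrals or
spherical coordinates. For \<open>h\<close> with gradient \<open>G\<close>, let \<open>\<psi> s\<close> be the integral of \<open>h (c + s q)\<close> over
\<open>q\<close> in the closed unit ball. The \<open>s\<close>-derivative of \<open>\<psi>\<close> is the integral of \<open>G (c + s q) \<bullet> q\<close>.
Since \<open>- q\<close> is the gradient of the weight \<open>(1 - \<bar>q\<bar>\<^sup>2) / 2\<close>, which vanishes on the unit sphere,
integration by parts (\<open>unit_ball_integral_by_parts\<close>) turns this into \<open>s\<close> times the integral of
the weight against the Laplacian of \<open>h\<close>, that is, into \<open>0\<close>. So \<open>\<psi>\<close> is constant; its value at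
\<open>s = r\<close> is the rescaled integral of \<open>h\<close> over the ball of radius \<open>r\<close>, its value at \<open>0\<close> is \<open>h c\<close>
times the volume of the unit ball.
\<close>

section \<open>Integration by parts on the unit ball\<close>

text \<open>Translation invariance makes every difference quotient of \<open>f\<close> in direction \<open>b\<close> integrate
to \<open>0\<close>; the Lipschitz bound dominates the quotients, so the limit integrates to \<open>0\<close> as well. This
replaces Fubini's theorem together with the fundamental theorem of calculus, and it tolerates a
null set of points where \<open>f\<close> has a kink.\<close>

lemma lipschitz_compact_support_integral_derivative:
  fixes f f' :: "'a::euclidean_space \<Rightarrow> real"
  assumes lip: "L-lipschitz_on UNIV f"
    and supp: "\<And>x. x \<notin> cball c r \<Longrightarrow> f x = 0"
    and der: "AE x in lborel. ((\<lambda>t. f (x + t *\<^sub>R b)) has_real_derivative f' x) (at 0)"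
    and meas: "f' \<in> borel_measurable lborel"
  shows "has_bochner_integral lborel f' 0"
proof -
  define h where "h n = inverse (real (Suc n))" for n
  have h: "h n > 0" "h n \<le> 1" "h n \<noteq> 0" for n
    by (auto simp: h_def field_simps)
  define s where "s n x = (f (x + h n *\<^sub>R b) - f x) / h n" for n x
  \<comment> \<open>The steps \<open>h n\<close> are at most \<open>1\<close>, so all quotients are supported in the ball enlarged by \<open>norm b\<close>.\<close>
  define w where "w x = indicator (cball c (r + norm b)) x *\<^sub>R (L * norm b)" for x
  have cont: "continuous_on UNIV f"
    using lip by (rule lipschitz_on_continuous_on)
  have [measurable]: "f \<in> borel_measurable borel"
    using cont by (rule borel_measurable_continuous_onI)
  have "(\<lambda>x. indicator (cball c r) x *\<^sub>R f x) = f"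
    using supp by (auto simp: indicator_def fun_eq_iff)
  with borel_integrable_compact[OF compact_cball continuous_on_subset[OF cont], of c r]
  have int_f: "integrable lborel f" by simp
  have int_sh: "integrable lborel (\<lambda>x. f (x + v))"
    and sh: "integral\<^sup>L lborel (\<lambda>x. f (x + v)) = integral\<^sup>L lborel f" for v
  proof -
    show "integrable lborel (\<lambda>x. f (x + v))"
      using int_f integrable_distr_eq[of "(+) v" lborel borel f]
      by (simp add: lborel_distr_plus add.commute)
    show "integral\<^sup>L lborel (\<lambda>x. f (x + v)) = integral\<^sup>L lborel f"
      using integral_distr[of "(+) v" lborel borel f] by (simp add: lborel_distr_plus add.commute)
  qed
  have s0: "integral\<^sup>L lborel (s n) = 0" for n
    unfolding s_def using int_f int_sh sh by (simp add: Bochner_Integration.integral_diff)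
  have meas_s: "s n \<in> borel_measurable lborel" for n
    unfolding s_def by measurable
  have int_w: "integrable lborel w"
    unfolding w_def by (rule borel_integrable_compact) auto
  have lim: "AE x in lborel. (\<lambda>n. s n x) \<longlonglongrightarrow> f' x"
    using der
  proof eventually_elim
    case (elim x)
    have "(\<lambda>t. (f (x + t *\<^sub>R b) - f x) / t) \<midarrow>0\<rightarrow> f' x"
      using elim by (simp add: DERIV_def)
    moreover have "filterlim h (at 0) sequentially"
      using LIMSEQ_inverse_real_of_nat h(3) unfolding h_def
      by (auto simp: filterlim_at)
    ultimately show ?case
      unfolding s_def by (rule filterlim_compose)
  qed
  have bound: "AE x in lborel. norm (s n x) \<le> w x" for n
  proof (rule AE_I2)
    fix x
    show "norm (s n x) \<le> w x"
    proof (cases "x \<in> cball c (r + norm b)")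
      case True
      have "\<bar>f (x + h n *\<^sub>R b) - f x\<bar> \<le> L * (h n * norm b)"
        using lipschitz_onD[OF lip, of "x + h n *\<^sub>R b" x] h(1)[of n] by (simp add: dist_norm)
      then show ?thesis
        using h(1)[of n] True by (simp add: s_def w_def field_simps)
    next
      case False
      have "norm (h n *\<^sub>R b) \<le> norm b"
        using h(1,2)[of n] by (simp add: mult_left_le_one_le)
      moreover have "dist c x \<le> dist c (x + h n *\<^sub>R b) + norm (h n *\<^sub>R b)"
        using dist_triangle[of c x "x + h n *\<^sub>R b"] by (simp add: dist_norm)
      ultimately have "f (x + h n *\<^sub>R b) = 0" "f x = 0"
        using False norm_ge_zero[of b] by (intro supp; simp; linarith)+
      then show ?thesis using False by (simp add: s_def w_def)
    qed
  qed
  have "integrable lborel f'"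
    by (rule integrable_dominated_convergence[OF meas meas_s int_w lim bound])
  moreover have "(\<lambda>n. integral\<^sup>L lborel (s n)) \<longlonglongrightarrow> integral\<^sup>L lborel f'"
    by (rule integral_dominated_convergence[OF meas meas_s int_w lim bound])
  ultimately show ?thesis
    using s0 by (simp add: has_bochner_integral_iff LIMSEQ_const_iff)
qed

text \<open>The function \<open>(1 - \<bar>x\<bar>\<^sup>2) / 2 * k x\<close>, extended by \<open>0\<close> outside the unit ball, is Lipschitz
because the weight vanishes on the sphere, and it is differentiable off the sphere, which is a
null set. The integrand below is its partial derivative along \<open>i\<close>.\<close>

lemma unit_ball_integral_by_parts:
  fixes k k' :: "'a::euclidean_space \<Rightarrow> real"
  assumes i: "i \<in> Basis"
    and lip: "L-lipschitz_on (cball 0 1) k"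
    and der: "\<And>x. x \<in> ball 0 1 \<Longrightarrow> ((\<lambda>t. k (x + t *\<^sub>R i)) has_real_derivative k' x) (at 0)"
    and cont: "continuous_on (cball 0 1) k'"
  shows "has_bochner_integral lborel
    (\<lambda>x. indicator (cball 0 1) x * ((1 - (norm x)\<^sup>2) / 2 * k' x - (x \<bullet> i) * k x)) 0"
proof -
  define g :: "'a \<Rightarrow> real" where "g x = (1 - (norm x)\<^sup>2) / 2" for x
  define f where "f x = (if x \<in> cball 0 1 then g x * k x else 0)" for x
  have cont_k: "continuous_on (cball 0 1) k"
    using lip by (rule lipschitz_on_continuous_on)
  have "compact (k ` cball 0 1)"
    by (rule compact_continuous_image[OF cont_k compact_cball])
  then obtain K where K: "\<And>x. x \<in> cball 0 1 \<Longrightarrow> \<bar>k x\<bar> \<le> K"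
    using compact_imp_bounded bounded_iff by (metis image_eqI real_norm_def)
  have K0: "0 \<le> K" using K[of 0] by simp
  have L0: "0 \<le> L" using lip by (rule lipschitz_on_nonneg)
  have g_range: "0 \<le> g x" "g x \<le> 1" "g x \<le> 1 - norm x" if "norm x \<le> 1" for x
  proof -
    show "0 \<le> g x" using that by (simp add: g_def power_le_one)
    show "g x \<le> 1" unfolding g_def by (simp add: divide_simps) (smt (verit) zero_le_power2)
    have "0 \<le> (1 - norm x)\<^sup>2" by simp
    then show "g x \<le> 1 - norm x" by (simp add: g_def power2_eq_square field_simps)
  qed
  have g_diff: "\<bar>g x - g y\<bar> \<le> norm (x - y)" if "norm x \<le> 1" "norm y \<le> 1" for x y
  proof -
    have "g x - g y = (norm y - norm x) * ((norm x + norm y) / 2)"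
      by (simp add: g_def power2_eq_square field_simps)
    also have "\<bar>\<dots>\<bar> \<le> \<bar>norm y - norm x\<bar> * 1"
      unfolding abs_mult using that by (intro mult_left_mono) auto
    also have "\<dots> \<le> norm (x - y)"
      using norm_triangle_ineq3[of x y] by simp
    finally show ?thesis .
  qed
  \<comment> \<open>Across the sphere it is enough that the weight is at most the distance to the sphere.\<close>
  have in_out: "\<bar>f x - f y\<bar> \<le> (K + L) * norm (x - y)" if "norm x \<le> 1" "\<not> norm y \<le> 1" for x y
  proof -
    have "\<bar>f x - f y\<bar> = g x * \<bar>k x\<bar>"
      using that g_range[of x] by (simp add: f_def abs_mult)
    also have "\<dots> \<le> norm (x - y) * K"
    proof (rule mult_mono)
      show "g x \<le> norm (x - y)"
        using g_range(3)[of x] that norm_triangle_ineq3[of x y] by linarith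
    qed (use K that in auto)
    also have "\<dots> \<le> (K + L) * norm (x - y)"
      using L0 by (simp add: algebra_simps)
    finally show ?thesis .
  qed
  have lip_f: "(K + L)-lipschitz_on UNIV f"
  proof (rule lipschitz_onI)
    fix x y :: 'a
    consider "norm x \<le> 1" "norm y \<le> 1" | "norm x \<le> 1" "\<not> norm y \<le> 1"
      | "\<not> norm x \<le> 1" "norm y \<le> 1" | "\<not> norm x \<le> 1" "\<not> norm y \<le> 1" by blast
    then show "dist (f x) (f y) \<le> (K + L) * dist x y"
    proof cases
      case 1
      have "f x - f y = (g x - g y) * k x + g y * (k x - k y)"
        using 1 by (simp add: f_def algebra_simps)
      also have "\<bar>\<dots>\<bar> \<le> \<bar>g x - g y\<bar> * \<bar>k x\<bar> + \<bar>g y\<bar> * \<bar>k x - k y\<bar>"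
        unfolding abs_mult[symmetric] by (rule abs_triangle_ineq)
      also have "\<dots> \<le> norm (x - y) * K + 1 * (L * norm (x - y))"
        using g_diff[OF 1] K[of x] g_range[of y] 1 lipschitz_onD[OF lip, of x y]
        by (intro add_mono mult_mono) (auto simp: dist_norm)
      finally show ?thesis by (simp add: dist_norm algebra_simps)
    next
      case 2
      then show ?thesis using in_out[of x y] by (simp add: dist_norm)
    next
      case 3
      then show ?thesis using in_out[of y x] by (simp add: dist_norm norm_minus_commute abs_minus_commute)
    next
      case 4
      then show ?thesis using K0 L0 by (simp add: f_def)
    qed
  qed (use K0 L0 in simp)
  have "sphere (0::'a) 1 \<in> null_sets lborel"
    using negligible_sphere[of "0::'a" 1]
    by (auto simp: null_sets_completion_iff negligible_iff_null_sets)
  then have ae: "AE x in lborel. x \<notin> sphere (0::'a) 1"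
    by (rule AE_not_in)
  define f' where "f' x = indicator (cball 0 1) x *\<^sub>R (g x * k' x - (x \<bullet> i) * k x)" for x
  have "has_bochner_integral lborel f' 0"
  proof (rule lipschitz_compact_support_integral_derivative[OF lip_f])
    show "f x = 0" if "x \<notin> cball 0 1" for x
      using that by (simp add: f_def)
    have "f' \<in> borel_measurable borel"
      unfolding f'_def g_def
      by (rule borel_measurable_continuous_on_indicator)
        (auto intro!: continuous_intros cont cont_k)
    then show "f' \<in> borel_measurable lborel" by simp
    show "AE x in lborel. ((\<lambda>t. f (x + t *\<^sub>R i)) has_real_derivative f' x) (at 0)"
      using ae
    proof eventually_elim
      case (elim x)
      have line: "((\<lambda>t::real. x + t *\<^sub>R i) \<longlongrightarrow> x) (at 0)"
        by (auto intro!: tendsto_eq_intros)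
      show ?case
      proof (cases "norm x < 1")
        case True
        have gd: "((\<lambda>t. g (x + t *\<^sub>R i)) has_real_derivative - (x \<bullet> i)) (at 0)"
          unfolding g_def power2_norm_eq_inner
          by (auto intro!: derivative_eq_intros simp: has_field_derivative_def inner_commute fun_eq_iff)
        have "((\<lambda>t. g (x + t *\<^sub>R i) * k (x + t *\<^sub>R i)) has_real_derivative
            f' x) (at 0)"
          using DERIV_mult[OF gd der[of x]] True by (simp add: f'_def algebra_simps)
        moreover have "\<forall>\<^sub>F t in at 0. x + t *\<^sub>R i \<in> ball 0 1"
          using topological_tendstoD[OF line, of "ball 0 1"] True by simp
        then have "\<forall>\<^sub>F t in at 0. g (x + t *\<^sub>R i) * k (x + t *\<^sub>R i) = f (x + t *\<^sub>R i)"
          by eventually_elim (simp add: f_def)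
        ultimately show ?thesis
          using True unfolding has_field_derivative_def
          by (elim has_derivative_transform_eventually) (auto simp: f_def)
      next
        case False
        with elim have out: "x \<in> - cball 0 1" by auto
        have "\<forall>\<^sub>F t in at 0. x + t *\<^sub>R i \<in> - cball 0 1"
          using topological_tendstoD[OF line, of "- cball 0 1"] out
          by (simp add: open_Compl)
        then have "\<forall>\<^sub>F t in at 0. 0 = f (x + t *\<^sub>R i)"
          by eventually_elim (simp add: f_def)
        moreover have "((\<lambda>t::real. 0) has_real_derivative f' x) (at 0)"
          using out by (simp add: f'_def)
        ultimately show ?thesis
          using out unfolding has_field_derivative_def
          by (elim has_derivative_transform_eventually) (auto simp: f_def)
      qed
    qed
  qed
  then show ?thesis
    by (simp add: f'_def[abs_def] g_def)
qed

section \<open>The mean value property of harmonic functions\<close>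

lemma continuous_derivative_imp_lipschitz_on_compact_convex:
  fixes G :: "'a::euclidean_space \<Rightarrow> 'b::real_normed_vector"
  assumes "compact S" "convex S"
    and der: "\<And>p. p \<in> S \<Longrightarrow> (G has_derivative DG p) (at p within S)"
    and cont: "\<And>v. v \<in> Basis \<Longrightarrow> continuous_on S (\<lambda>p. DG p v)"
  obtains L where "L-lipschitz_on S G"
proof -
  have "\<exists>B. \<forall>p\<in>S. norm (DG p v) \<le> B" if "v \<in> Basis" for v
  proof -
    have "bounded ((\<lambda>p. DG p v) ` S)"
      by (intro compact_imp_bounded compact_continuous_image cont that \<open>compact S\<close>)
    then show ?thesis by (auto simp: bounded_iff)
  qed
  then obtain B where B: "\<And>v p. v \<in> Basis \<Longrightarrow> p \<in> S \<Longrightarrow> norm (DG p v) \<le> B v"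
    by metis
  have bd: "onorm (DG p) \<le> (\<Sum>v\<in>Basis. \<bar>B v\<bar>)" if p: "p \<in> S" for p
  proof (rule onorm_le)
    fix x
    interpret bounded_linear "DG p"
      using der[OF p] by (rule has_derivative_bounded_linear)
    have "DG p x = DG p (\<Sum>v\<in>Basis. (x \<bullet> v) *\<^sub>R v)"
      by (simp add: euclidean_representation)
    also have "\<dots> = (\<Sum>v\<in>Basis. (x \<bullet> v) *\<^sub>R DG p v)"
      by (simp add: sum scaleR)
    also have "norm \<dots> \<le> (\<Sum>v\<in>Basis. norm x * \<bar>B v\<bar>)"
    proof (rule order_trans[OF norm_sum sum_mono])
      fix v :: 'a assume v: "v \<in> Basis"
      show "norm ((x \<bullet> v) *\<^sub>R DG p v) \<le> norm x * \<bar>B v\<bar>"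
        using B[OF v p] Basis_le_norm[OF v, of x] by (auto intro!: mult_mono)
    qed
    finally show "norm (DG p x) \<le> (\<Sum>v\<in>Basis. \<bar>B v\<bar>) * norm x"
      by (simp add: sum_distrib_left mult.commute)
  qed
  have "(\<Sum>v\<in>Basis. \<bar>B v\<bar>)-lipschitz_on S G"
  proof (rule lipschitz_onI)
    fix x y assume "x \<in> S" "y \<in> S"
    with differentiable_bound[OF \<open>convex S\<close> der bd]
    show "dist (G x) (G y) \<le> (\<Sum>v\<in>Basis. \<bar>B v\<bar>) * dist x y"
      by (simp add: dist_norm)
  qed (simp add: sum_nonneg)
  then show thesis by (rule that)
qed


lemma set_integral_cball_rescale:
  fixes h :: "'a::euclidean_space \<Rightarrow> real"
  assumes r: "r > 0" and cont: "continuous_on (cball c r) h"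
  shows "(LINT p:cball c r|lborel. h p) =
    r ^ DIM('a) * (LINT q:cball 0 1|lborel. h (c + r *\<^sub>R q))"
proof -
  define F where "F p = indicator (cball c r) p *\<^sub>R h p" for p
  have [measurable]: "F \<in> borel_measurable borel"
    unfolding F_def by (intro borel_measurable_continuous_on_indicator cont) auto
  have F: "F (c + r *\<^sub>R q) = indicator (cball 0 1) q *\<^sub>R h (c + r *\<^sub>R q)" for q
    using r by (auto simp: F_def indicator_def dist_norm)
  have "(LINT p:cball c r|lborel. h p) = integral\<^sup>L lborel F"
    by (simp add: set_lebesgue_integral_def F_def[abs_def])
  also have "\<dots> = integral\<^sup>L (density (distr lborel borel (\<lambda>q. c + r *\<^sub>R q)) (\<lambda>_. ennreal (r ^ DIM('a)))) F"
    using lborel_affine[of r c] r by (simp add: ennreal_power)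
  also have "\<dots> = (LINT q|lborel. r ^ DIM('a) *\<^sub>R F (c + r *\<^sub>R q))"
    using r by (simp add: integral_density integral_distr)
  finally show ?thesis
    by (simp add: F set_lebesgue_integral_def)
qed

text \<open>The family \<open>DG\<close> is the Hessian of \<open>h\<close>, so the last hypothesis says that the Laplacian of \<open>h\<close>
vanishes. Differentiation under the integral sign is avoided: as the gradient is Lipschitz, \<open>h\<close>
is linear along rays up to a quadratic error, so the increments of \<open>\<psi>\<close> are quadratically small
once the integral of \<open>G (c + s q) \<bullet> q\<close> is known to vanish, and this forces the derivative of \<open>\<psi>\<close> to be \<open>0\<close>.\<close>

theorem harmonic_mean_value_cball:
  fixes h :: "'a::euclidean_space \<Rightarrow> real" and G :: "'a \<Rightarrow> 'a"
  assumes r: "r > 0"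
    and grad: "\<And>p. p \<in> cball c r \<Longrightarrow> (h has_derivative (\<lambda>v. G p \<bullet> v)) (at p)"
    and hess: "\<And>p. p \<in> cball c r \<Longrightarrow> (G has_derivative DG p) (at p)"
    and cont: "\<And>v. v \<in> Basis \<Longrightarrow> continuous_on (cball c r) (\<lambda>p. DG p v)"
    and harm: "\<And>p. p \<in> cball c r \<Longrightarrow> (\<Sum>i\<in>Basis. DG p i \<bullet> i) = 0"
  shows "(LINT p:cball c r|lborel. h p) = measure lborel (cball c r) * h c"
proof -
  obtain L where L: "L-lipschitz_on (cball c r) G"
  proof (rule continuous_derivative_imp_lipschitz_on_compact_convex[of "cball c r" G DG])
    show "(G has_derivative DG p) (at p within cball c r)" if "p \<in> cball c r" for p
      using hess[OF that] by (rule has_derivative_at_withinI)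
  qed (use cont in auto)
  have L0: "L \<ge> 0" using L by (rule lipschitz_on_nonneg)
  have cont_h: "continuous_on (cball c r) h"
    using grad has_derivative_continuous continuous_at_imp_continuous_on by blast
  have in_ball: "c + s *\<^sub>R q \<in> cball c r" if "s \<in> {0..r}" "q \<in> cball 0 1" for s q
    using that mult_mono[of s r "norm q" 1] by (simp add: dist_norm)
  \<comment> \<open>The radial component of the gradient integrates to \<open>0\<close>: sum the integration by parts over the
    coordinates, and let the trace of the Hessian vanish.\<close>
  have flux: "has_bochner_integral lborel
      (\<lambda>q. indicator (cball 0 1) q * (G (c + s *\<^sub>R q) \<bullet> q)) 0" if s: "s \<in> {0..r}" for s
  proof -
    have cont_comp: "continuous_on (cball 0 1) (\<lambda>q. f (c + s *\<^sub>R q))"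
      if "continuous_on (cball c r) f" for f :: "'a \<Rightarrow> 'a"
      by (rule continuous_on_compose2[OF that]) (use in_ball s in \<open>auto intro!: continuous_intros\<close>)
    have parts: "has_bochner_integral lborel
        (\<lambda>q. indicator (cball 0 1) q * ((1 - (norm q)\<^sup>2) / 2 * (s * (DG (c + s *\<^sub>R q) i \<bullet> i))
          - (q \<bullet> i) * (G (c + s *\<^sub>R q) \<bullet> i))) 0" if i: "i \<in> Basis" for i
    proof (rule unit_ball_integral_by_parts[OF i, where L = "L * s"])
      show "(L * s)-lipschitz_on (cball 0 1) (\<lambda>q. G (c + s *\<^sub>R q) \<bullet> i)"
      proof (rule lipschitz_onI)
        fix x y :: 'a assume xy: "x \<in> cball 0 1" "y \<in> cball 0 1"
        have "\<bar>(G (c + s *\<^sub>R x) - G (c + s *\<^sub>R y)) \<bullet> i\<bar> \<le> norm (G (c + s *\<^sub>R x) - G (c + s *\<^sub>R y))"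
          using i by (rule Basis_le_norm)
        also have "\<dots> \<le> L * dist (c + s *\<^sub>R x) (c + s *\<^sub>R y)"
          using lipschitz_onD[OF L in_ball[OF s xy(1)] in_ball[OF s xy(2)]] by (simp add: dist_norm)
        also have "dist (c + s *\<^sub>R x) (c + s *\<^sub>R y) = s * dist x y"
          using s by (simp add: dist_norm flip: scaleR_diff_right)
        finally show "dist (G (c + s *\<^sub>R x) \<bullet> i) (G (c + s *\<^sub>R y) \<bullet> i) \<le> L * s * dist x y"
          by (simp add: dist_norm inner_diff_left mult.assoc)
      qed (use L0 s in simp)
    next
      fix x :: 'a assume x: "x \<in> ball 0 1"
      have p: "c + s *\<^sub>R x \<in> cball c r" using in_ball[OF s] x by simp
      interpret D: bounded_linear "DG (c + s *\<^sub>R x)"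
        using hess[OF p] by (rule has_derivative_bounded_linear)
      have "((\<lambda>t. c + s *\<^sub>R (x + t *\<^sub>R i)) has_derivative (\<lambda>t. s *\<^sub>R t *\<^sub>R i)) (at 0)"
        by (auto intro!: derivative_eq_intros)
      from has_derivative_compose[OF this, of G "DG (c + s *\<^sub>R x)"] hess[OF p]
      have "((\<lambda>t. G (c + s *\<^sub>R (x + t *\<^sub>R i))) has_derivative (\<lambda>t. DG (c + s *\<^sub>R x) (s *\<^sub>R t *\<^sub>R i))) (at 0)"
        by simp
      from has_derivative_inner_left[OF this, of i]
      show "((\<lambda>t. G (c + s *\<^sub>R (x + t *\<^sub>R i)) \<bullet> i) has_real_derivative
          s * (DG (c + s *\<^sub>R x) i \<bullet> i)) (at 0)"
        unfolding has_field_derivative_def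
        by (rule has_derivative_eq_rhs) (simp add: D.scaleR fun_eq_iff)
    next
      show "continuous_on (cball 0 1) (\<lambda>q. s * (DG (c + s *\<^sub>R q) i \<bullet> i))"
        by (intro continuous_intros cont_comp[of "\<lambda>p. DG p i"] cont i)
    qed
    have "has_bochner_integral lborel (\<lambda>q. \<Sum>i\<in>Basis.
        indicator (cball 0 1) q * ((1 - (norm q)\<^sup>2) / 2 * (s * (DG (c + s *\<^sub>R q) i \<bullet> i))
          - (q \<bullet> i) * (G (c + s *\<^sub>R q) \<bullet> i))) (\<Sum>i\<in>(Basis :: 'a set). 0)"
      by (rule has_bochner_integral_sum) (rule parts)
    also have "(\<lambda>q. \<Sum>i\<in>Basis.
        indicator (cball 0 1) q * ((1 - (norm q)\<^sup>2) / 2 * (s * (DG (c + s *\<^sub>R q) i \<bullet> i))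
          - (q \<bullet> i) * (G (c + s *\<^sub>R q) \<bullet> i)))
      = (\<lambda>q. - (indicator (cball 0 1) q * (G (c + s *\<^sub>R q) \<bullet> q)))"
    proof
      fix q :: 'a
      show "(\<Sum>i\<in>Basis. indicator (cball 0 1) q * ((1 - (norm q)\<^sup>2) / 2 * (s * (DG (c + s *\<^sub>R q) i \<bullet> i))
          - (q \<bullet> i) * (G (c + s *\<^sub>R q) \<bullet> i)))
        = - (indicator (cball 0 1) q * (G (c + s *\<^sub>R q) \<bullet> q))"
      proof (cases "q \<in> cball 0 1")
        case True
        have "(\<Sum>i\<in>Basis. (1 - (norm q)\<^sup>2) / 2 * (s * (DG (c + s *\<^sub>R q) i \<bullet> i))
            - (q \<bullet> i) * (G (c + s *\<^sub>R q) \<bullet> i))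
          = (1 - (norm q)\<^sup>2) / 2 * (s * (\<Sum>i\<in>Basis. DG (c + s *\<^sub>R q) i \<bullet> i))
            - (\<Sum>i\<in>Basis. (q \<bullet> i) * (G (c + s *\<^sub>R q) \<bullet> i))"
          by (simp only: sum_subtractf sum_distrib_left)
        also have "\<dots> = - (G (c + s *\<^sub>R q) \<bullet> q)"
          using harm[OF in_ball[OF s True]]
          by (simp add: euclidean_inner[of "G (c + s *\<^sub>R q)" q] mult.commute)
        finally show ?thesis using True by simp
      qed simp
    qed
    finally show ?thesis
      using has_bochner_integral_minus by fastforce
  qed
  define \<psi> where "\<psi> s = (LINT q:cball 0 1|lborel. h (c + s *\<^sub>R q))" for s
  define vol where "vol = measure lborel (cball (0::'a) 1)"
  have vol: "(LINT q:cball (0::'a) 1|lborel. k) = k * vol" for k :: real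
    by (simp add: set_lebesgue_integral_def vol_def)
  have int_h: "set_integrable lborel (cball 0 1) (\<lambda>q. h (c + s *\<^sub>R q))" if s: "s \<in> {0..r}" for s
    unfolding set_integrable_def
    by (intro borel_integrable_compact compact_cball continuous_on_compose2[OF cont_h])
      (use in_ball s in \<open>auto intro!: continuous_intros\<close>)
  have second_order: "\<bar>\<psi> t - \<psi> s\<bar> \<le> L * vol * \<bar>t - s\<bar>\<^sup>2" if s: "s \<in> {0..r}" and t: "t \<in> {0..r}" for s t
  proof -
    have taylor: "\<bar>h (c + t *\<^sub>R q) - h (c + s *\<^sub>R q) - (t - s) * (G (c + s *\<^sub>R q) \<bullet> q)\<bar> \<le> L * \<bar>t - s\<bar>\<^sup>2"
      if q: "q \<in> cball 0 1" for q
    proof -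
      let ?S = "closed_segment (c + s *\<^sub>R q) (c + t *\<^sub>R q)"
      have S: "?S \<subseteq> cball c r"
        using in_ball[OF s q] in_ball[OF t q] by (intro closed_segment_subset) auto
      have len: "norm (t *\<^sub>R q - s *\<^sub>R q) \<le> \<bar>t - s\<bar>"
        using q by (simp add: mult_left_le flip: scaleR_diff_left)
      have "norm (h (c + t *\<^sub>R q) - h (c + s *\<^sub>R q) - G (c + s *\<^sub>R q) \<bullet> (c + t *\<^sub>R q - (c + s *\<^sub>R q)))
        \<le> norm (c + t *\<^sub>R q - (c + s *\<^sub>R q)) * (L * \<bar>t - s\<bar>)"
      proof (rule differentiable_bound_linearization[where S = ?S and f' = "\<lambda>p v. G p \<bullet> v"])
        fix u :: real assume "u \<in> {0..1}"
        then show "c + s *\<^sub>R q + u *\<^sub>R (c + t *\<^sub>R q - (c + s *\<^sub>R q)) \<in> ?S"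
          by (auto simp: closed_segment_def algebra_simps intro!: exI[of _ u])
      next
        fix x assume x: "x \<in> ?S"
        show "(h has_derivative (\<lambda>v. G x \<bullet> v)) (at x within ?S)"
          using has_derivative_at_withinI[OF grad] x S by blast
        have "norm (G x - G (c + s *\<^sub>R q)) \<le> L * dist x (c + s *\<^sub>R q)"
          using lipschitz_onD[OF L, of x "c + s *\<^sub>R q"] x S in_ball[OF s q] by (auto simp: dist_norm)
        also have "\<dots> \<le> L * norm (t *\<^sub>R q - s *\<^sub>R q)"
          using segment_bound(1)[OF x] L0 by (intro mult_left_mono) (auto simp: dist_norm)
        also have "\<dots> \<le> L * \<bar>t - s\<bar>"
          using len L0 by (rule mult_left_mono)
        finally have G: "norm (G x - G (c + s *\<^sub>R q)) \<le> L * \<bar>t - s\<bar>" .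
        show "onorm ((\<lambda>v. G x \<bullet> v) - (\<lambda>v. G (c + s *\<^sub>R q) \<bullet> v)) \<le> L * \<bar>t - s\<bar>"
        proof (rule onorm_le)
          fix v
          have "norm ((G x - G (c + s *\<^sub>R q)) \<bullet> v) \<le> norm (G x - G (c + s *\<^sub>R q)) * norm v"
            by (simp add: Cauchy_Schwarz_ineq2)
          also have "\<dots> \<le> L * \<bar>t - s\<bar> * norm v"
            using G by (simp add: mult_right_mono)
          finally show "norm (((\<lambda>v. G x \<bullet> v) - (\<lambda>v. G (c + s *\<^sub>R q) \<bullet> v)) v) \<le> L * \<bar>t - s\<bar> * norm v"
            by (simp add: inner_diff_left)
        qed
      qed simp
      also have "\<dots> \<le> \<bar>t - s\<bar> * (L * \<bar>t - s\<bar>)"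
        using len L0 by (intro mult_right_mono) auto
      also have "G (c + s *\<^sub>R q) \<bullet> (c + t *\<^sub>R q - (c + s *\<^sub>R q)) = (t - s) * (G (c + s *\<^sub>R q) \<bullet> q)"
        by (simp add: algebra_simps)
      finally show ?thesis by (simp add: power2_eq_square mult_ac)
    qed
    have int_G: "set_integrable lborel (cball 0 1) (\<lambda>q. G (c + s *\<^sub>R q) \<bullet> q)"
      and int_G0: "(LINT q:cball 0 1|lborel. G (c + s *\<^sub>R q) \<bullet> q) = 0"
      using flux[OF s] by (auto simp: set_integrable_def set_lebesgue_integral_def has_bochner_integral_iff)
    let ?d = "\<lambda>q. h (c + t *\<^sub>R q) - h (c + s *\<^sub>R q) - (t - s) * (G (c + s *\<^sub>R q) \<bullet> q)"
    have int_d: "set_integrable lborel (cball 0 1) ?d"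
      using int_h[OF s] int_h[OF t] int_G by (intro set_integral_diff set_integrable_mult_right) auto
    have "\<psi> t - \<psi> s = (LINT q:cball 0 1|lborel. ?d q)"
      using int_h[OF s] int_h[OF t] int_G int_G0
      by (simp add: set_integral_diff set_integrable_mult_right set_integral_mult_right \<psi>_def)
    also have "\<bar>\<dots>\<bar> \<le> (LINT q:cball (0::'a) 1|lborel. L * \<bar>t - s\<bar>\<^sup>2)"
      unfolding set_lebesgue_integral_def real_norm_def[symmetric]
    proof (rule Bochner_Integration.integral_norm_bound_integral)
      show "integrable lborel (\<lambda>q. indicator (cball 0 1) q *\<^sub>R ?d q)"
        using int_d by (simp add: set_integrable_def)
      show "integrable lborel (\<lambda>q::'a. indicator (cball 0 1) q *\<^sub>R (L * (norm (t - s))\<^sup>2))"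
        by (rule borel_integrable_compact) auto
    qed (use taylor in \<open>auto simp: indicator_def\<close>)
    also have "\<dots> = L * vol * \<bar>t - s\<bar>\<^sup>2" by (simp add: vol)
    finally show ?thesis .
  qed
  have "\<psi> r = \<psi> 0"
  proof (rule has_derivative_zero_unique[of "{0..r}" \<psi> r 0])
    fix s assume s: "s \<in> {0..r}"
    have "((\<lambda>t. (\<psi> t - \<psi> s) / (t - s)) \<longlongrightarrow> 0) (at s within {0..r})"
    proof (rule Lim_null_comparison)
      have "norm ((\<psi> t - \<psi> s) / (t - s)) \<le> L * vol * \<bar>t - s\<bar>" if "t \<in> {0..r}" "t \<noteq> s" for t
        using second_order[OF s that(1)] that(2) by (simp add: divide_simps power2_eq_square mult_ac)
      then show "\<forall>\<^sub>F t in at s within {0..r}. norm ((\<psi> t - \<psi> s) / (t - s)) \<le> L * vol * \<bar>t - s\<bar>"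
        by (auto simp: eventually_at_filter)
      show "((\<lambda>t. L * vol * \<bar>t - s\<bar>) \<longlongrightarrow> 0) (at s within {0..r})"
        by (auto intro!: tendsto_eq_intros)
    qed
    then have "(\<psi> has_field_derivative 0) (at s within {0..r})"
      by (simp add: has_field_derivative_iff)
    then show "(\<psi> has_derivative (\<lambda>_. 0)) (at s within {0..r})"
      by (simp add: has_field_derivative_def lambda_zero)
  qed (use r in simp_all)
  also have "\<psi> 0 = h c * vol"
    by (simp add: \<psi>_def vol)
  finally have "\<psi> r = h c * vol" .
  moreover have "measure lborel (cball c r) = r ^ DIM('a) * vol"
  proof -
    have "measure lborel (cball c r) = (LINT p:cball c r|lborel. 1)"
      by (simp add: set_lebesgue_integral_def)
    also have "\<dots> = r ^ DIM('a) * vol"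
      by (simp only: set_integral_cball_rescale[OF r continuous_on_const] vol mult_1)
    finally show ?thesis .
  qed
  ultimately show ?thesis
    using set_integral_cball_rescale[OF r cont_h] by (simp add: \<psi>_def)
qed

section \<open>Attraction of a homogeneous ball\<close>

lemma has_derivative_inverse_norm_power:
  fixes P p :: "'a::real_inner"
  assumes "p \<noteq> P"
  shows "((\<lambda>p. inverse (norm (p - P) ^ k)) has_derivative
    (\<lambda>v. - real k * ((p - P) \<bullet> v) * inverse (norm (p - P) ^ (k + 2)))) (at p)"
proof -
  have n: "((\<lambda>p. norm (p - P)) has_derivative (\<lambda>v. v \<bullet> sgn (p - P))) (at p)"
    by (rule has_derivative_compose[where g = norm and f = "\<lambda>p. p - P", OF _ has_derivative_norm, simplified])
      (use assms in \<open>auto intro!: derivative_eq_intros\<close>)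
  show ?thesis
    using assms
    by (auto intro!: derivative_eq_intros n simp: fun_eq_iff sgn_div_norm inner_commute divide_simps power_add power2_eq_square)
      (cases k; simp)
qed

text \<open>Dimension \<open>3\<close> enters only in the trace of the Hessian: with \<open>N k\<close> the \<open>k\<close>-th inverse power of
the distance to \<open>P\<close>, the trace is \<open>(- 3 - 3 - 3 * DIM('a) + 15) * ((p - P) \<bullet> e) * N 5 p\<close>.\<close>

theorem newtonian_attraction_cball:
  fixes c e P :: "'a::euclidean_space"
  assumes dim: "DIM('a) = 3" and r: "r > 0" and P: "P \<notin> cball c r"
  shows "(LINT p:cball c r|lborel. ((p - P) \<bullet> e) / norm (p - P) ^ 3) =
    measure lborel (cball c r) * (((c - P) \<bullet> e) / norm (c - P) ^ 3)"
proof -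
  define N where "N k p = inverse (norm (p - P) ^ k)" for k :: nat and p
  define G where "G p = N 3 p *\<^sub>R e - (3 * ((p - P) \<bullet> e) * N 5 p) *\<^sub>R (p - P)" for p
  define DG where "DG p v = (- 3 * ((p - P) \<bullet> v) * N 5 p) *\<^sub>R e
      - (3 * (v \<bullet> e) * N 5 p) *\<^sub>R (p - P)
      + (15 * ((p - P) \<bullet> e) * ((p - P) \<bullet> v) * N 7 p) *\<^sub>R (p - P)
      - (3 * ((p - P) \<bullet> e) * N 5 p) *\<^sub>R v" for p v
  have dN: "(N k has_derivative (\<lambda>v. - real k * ((p - P) \<bullet> v) * N (k + 2) p)) (at p)" if "p \<noteq> P" for k p
    using has_derivative_inverse_norm_power[OF that, of k] by (simp add: N_def[abs_def])
  have "(LINT p:cball c r|lborel. ((p - P) \<bullet> e) * N 3 p) =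
      measure lborel (cball c r) * (((c - P) \<bullet> e) * N 3 c)"
  proof (rule harmonic_mean_value_cball[OF r])
    fix p assume p: "p \<in> cball c r"
    have pP: "p \<noteq> P" using p P by auto
    note [derivative_intros] = dN[OF pP]
    have N: "N 3 p = (norm (p - P))\<^sup>2 * N 5 p" "N 5 p = (norm (p - P))\<^sup>2 * N 7 p"
      using pP by (auto simp: N_def divide_simps simp flip: power_add)
    show "((\<lambda>p. ((p - P) \<bullet> e) * N 3 p) has_derivative (\<lambda>v. G p \<bullet> v)) (at p)"
      by (auto intro!: derivative_eq_intros simp: G_def fun_eq_iff algebra_simps inner_commute)
    show "(G has_derivative DG p) (at p)"
      unfolding G_def[abs_def] DG_def[abs_def]
      by (auto intro!: derivative_eq_intros simp: fun_eq_iff algebra_simps)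
    have sum1: "(\<Sum>i\<in>Basis. (a \<bullet> i) * (b \<bullet> i)) = a \<bullet> b" for a b :: 'a
      by (simp add: euclidean_inner[of a b])
    have "(\<Sum>i\<in>Basis. DG p i \<bullet> i)
       = (\<Sum>i\<in>Basis. (- 3 * N 5 p) * (((p - P) \<bullet> i) * (e \<bullet> i)) - (3 * N 5 p) * (e \<bullet> i * ((p - P) \<bullet> i))
        + (15 * ((p - P) \<bullet> e) * N 7 p) * (((p - P) \<bullet> i) * ((p - P) \<bullet> i)) - 3 * ((p - P) \<bullet> e) * N 5 p)"
      by (rule sum.cong) (auto simp: DG_def inner_diff_left inner_add_left inner_commute algebra_simps)
    also have "\<dots> = (- 3 * N 5 p) * ((p - P) \<bullet> e) - (3 * N 5 p) * (e \<bullet> (p - P))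
        + (15 * ((p - P) \<bullet> e) * N 7 p) * ((p - P) \<bullet> (p - P)) - 3 * (3 * ((p - P) \<bullet> e) * N 5 p)"
      by (simp only: sum_subtractf sum.distrib sum_distrib_left[symmetric] sum1 sum_constant dim)
    also have "\<dots> = 0"
      unfolding N(2) by (simp add: inner_commute[of e] power2_norm_eq_inner)
    finally show "(\<Sum>i\<in>Basis. DG p i \<bullet> i) = 0" .
  next
    fix v :: 'a
    show "continuous_on (cball c r) (\<lambda>p. DG p v)"
      unfolding DG_def N_def using P by (auto intro!: continuous_intros)
  qed
  then show ?thesis by (simp add: N_def divide_inverse)
qed

lemma power2_powr_three_halves:
  fixes t :: real
  assumes "t \<ge> 0"
  shows "(t\<^sup>2) powr (3/2) = t ^ 3"
proof (cases "t = 0")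
  case False
  with assms have "t > 0" by simp
  then have "(t\<^sup>2) powr (3/2) = (t powr 2) powr (3/2)" by simp
  also have "\<dots> = t powr 3" by (simp only: powr_powr) simp
  also have "\<dots> = t ^ 3" using \<open>t > 0\<close> by simp
  finally show ?thesis .
qed simp

text \<open>The vertical intensity is the component of the attraction along the third axis, and the
point of measurement lies outside the ball because the ball is strictly below the surface.\<close>

lemma vertical_intensity_homogeneous_ball:
  fixes x\<^sub>0 y\<^sub>0 z\<^sub>0 a x y \<gamma> \<rho> :: real
  defines "B \<equiv> cball (vector [x\<^sub>0, y\<^sub>0, z\<^sub>0] :: real^3) a"
  assumes a: "a > 0" and below: "B \<subseteq> {p. p$3 > 0}"
  shows "vertical_intensity \<gamma> B (\<lambda>_. \<rho>) x y =
    \<gamma> * body_mass B (\<lambda>_. \<rho>) * z\<^sub>0 / (z\<^sub>0\<^sup>2 + ((x - x\<^sub>0)\<^sup>2 + (y - y\<^sub>0)\<^sup>2)) powr (3/2)"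
proof -
  let ?c = "vector [x\<^sub>0, y\<^sub>0, z\<^sub>0] :: real^3"
  let ?P = "vector [x, y, 0] :: real^3"
  let ?e = "axis 3 1 :: real^3"
  have dist2: "(norm (p - ?P))\<^sup>2 = (x - p$1)\<^sup>2 + (y - p$2)\<^sup>2 + (p$3)\<^sup>2" for p
    unfolding power2_norm_eq_inner inner_vec_def sum_3
    by (simp add: vector_3 power2_eq_square algebra_simps)
  have comp: "(p - ?P) \<bullet> ?e = p$3" for p
    by (simp add: inner_axis vector_3)
  have kernel: "p$3 / ((x - p$1)\<^sup>2 + (y - p$2)\<^sup>2 + (p$3)\<^sup>2) powr (3/2)
      = ((p - ?P) \<bullet> ?e) / norm (p - ?P) ^ 3" for p
    unfolding comp dist2[symmetric] by (simp add: power2_powr_three_halves)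
  have "?P \<notin> B" using below by (auto simp: vector_3)
  then have outside: "?P \<notin> cball ?c a" by (simp add: B_def)
  have mass: "body_mass B (\<lambda>_. \<rho>) = measure lborel B * \<rho>"
    by (simp add: body_mass_def set_lebesgue_integral_def B_def)
  have "vertical_intensity \<gamma> B (\<lambda>_. \<rho>) x y =
      \<gamma> * (LINT p:B|lborel. \<rho> * (((p - ?P) \<bullet> ?e) / norm (p - ?P) ^ 3))"
    unfolding vertical_intensity_def times_divide_eq_right[symmetric] kernel ..
  also have "\<dots> = \<gamma> * (\<rho> * (measure lborel B * (((?c - ?P) \<bullet> ?e) / norm (?c - ?P) ^ 3)))"
    unfolding set_integral_mult_right B_def
    by (subst newtonian_attraction_cball[OF _ a outside]) simp_all
  also have "\<dots> = \<gamma> * body_mass B (\<lambda>_. \<rho>) * (?c$3 / ((x - ?c$1)\<^sup>2 + (y - ?c$2)\<^sup>2 + (?c$3)\<^sup>2) powr (3/2))"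
    unfolding kernel[symmetric] mass by simp
  finally show ?thesis by (simp add: vector_3 add_ac)
qed

section \<open>Depth and mass from two measurements\<close>

text \<open>The factor \<open>s\<^sup>2 - \<delta>\<^sup>2\<close> occurs in both \<open>q - (\<delta> / s)\<^sup>2\<close> and \<open>1 - q\<close>, and so does the
denominator of \<open>q\<close>; cancelling them leaves \<open>(z / s)\<^sup>2\<close> under the root.\<close>

lemma depth_from_intensity_ratio:
  fixes z s \<delta> :: real
  assumes z: "z > 0" and \<delta>: "0 \<le> \<delta>" "\<delta> < s"
  defines "q \<equiv> (z\<^sup>2 + \<delta>\<^sup>2) / (z\<^sup>2 + s\<^sup>2)"
  shows "sqrt ((q - (\<delta> / s)\<^sup>2) / (1 - q)) * s = z"
proof -
  have s: "s > 0" using \<delta> by simp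
  have D: "s\<^sup>2 - \<delta>\<^sup>2 > 0" using \<delta> by (simp add: power_strict_mono)
  define C where "C = z\<^sup>2 + s\<^sup>2"
  have C: "C > 0" using z by (simp add: C_def add_pos_nonneg)
  have q: "q = (z\<^sup>2 + \<delta>\<^sup>2) / C" by (simp add: q_def C_def)
  have "q - (\<delta> / s)\<^sup>2 = z\<^sup>2 * (s\<^sup>2 - \<delta>\<^sup>2) / (C * s\<^sup>2)"
    using C s unfolding q by (simp add: C_def field_simps)
  moreover have "1 - q = (C - (z\<^sup>2 + \<delta>\<^sup>2)) / C"
    using C unfolding q by (simp add: diff_divide_distrib)
  then have "1 - q = (s\<^sup>2 - \<delta>\<^sup>2) / C"
    by (simp add: C_def)
  ultimately have "(q - (\<delta> / s)\<^sup>2) / (1 - q) =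
      z\<^sup>2 * (s\<^sup>2 - \<delta>\<^sup>2) / (C * s\<^sup>2) / ((s\<^sup>2 - \<delta>\<^sup>2) / C)"
    by (simp only:)
  also have "\<dots> = (z / s)\<^sup>2"
    using C D s by (simp add: power_divide)
  finally show ?thesis using z s by simp
qed

theorem theorem4p3:
  fixes \<gamma> \<rho> a M x\<^sub>0 y\<^sub>0 z\<^sub>0 x y x\<^sub>c y\<^sub>c s \<Delta> \<nu> \<psi> \<mu> V\<^sub>P V\<^sub>C :: real
    and B :: "(real^3) set" and V :: "real \<Rightarrow> real \<Rightarrow> real"
  assumes "\<gamma> > 0"
    and "\<rho> > 0" and "a > 0" and "z\<^sub>0 > 0"
    and "B = cball (vector [x\<^sub>0, y\<^sub>0, z\<^sub>0]) a" and "B \<subseteq> {p. p$3 > 0}"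
    and "M = body_mass B (\<lambda>_. \<rho>)" and "M > 0"
    and "V = vertical_intensity \<gamma> B (\<lambda>_. \<rho>)"
    and "V\<^sub>P = V x y" and "V\<^sub>C = V x\<^sub>c y\<^sub>c"
    and "s = sqrt ((x - x\<^sub>0)\<^sup>2 + (y - y\<^sub>0)\<^sup>2)"
    and "\<Delta> = sqrt ((x\<^sub>c - x\<^sub>0)\<^sup>2 + (y\<^sub>c - y\<^sub>0)\<^sup>2)"
    and "\<Delta> < s"
    and "\<nu> = V\<^sub>P / V\<^sub>C" and "\<psi> = \<Delta> / s"
    and "\<mu> = sqrt ((\<nu> powr (2/3) - \<psi>\<^sup>2) / (1 - \<nu> powr (2/3)))"
  shows "(\<forall>x' y'. (x', y') \<noteq> (x\<^sub>0, y\<^sub>0) \<longrightarrow> V x' y' < V x\<^sub>0 y\<^sub>0) \<and>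
         z\<^sub>0 = \<mu> * s \<and>
         M = 1 / \<gamma> * ((z\<^sub>0\<^sup>2 + \<Delta>\<^sup>2) powr (3/2) / z\<^sub>0) * V\<^sub>C \<and>
         (\<Delta> = 0 \<longrightarrow>
            (x\<^sub>c, y\<^sub>c) = (x\<^sub>0, y\<^sub>0) \<and>
            (let \<nu>\<^sub>Q = V\<^sub>P / V x\<^sub>0 y\<^sub>0;
                 \<mu>\<^sub>Q = sqrt (\<nu>\<^sub>Q powr (2/3) / (1 - \<nu>\<^sub>Q powr (2/3)))
             in z\<^sub>0 = \<mu>\<^sub>Q * s \<and>
                M = 1 / \<gamma> * ((z\<^sub>0\<^sup>2 + s\<^sup>2) powr (3/2) / z\<^sub>0) * V\<^sub>P))"
proof -
  note a = assms(3) and z0 = assms(4) and B = assms(5) and M = assms(7)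
  have \<gamma>: "\<gamma> > 0" and M0: "M > 0" by fact+
  have V: "V u v = \<gamma> * M * z\<^sub>0 / (z\<^sub>0\<^sup>2 + ((u - x\<^sub>0)\<^sup>2 + (v - y\<^sub>0)\<^sup>2)) powr (3/2)" for u v
    using vertical_intensity_homogeneous_ball[OF a assms(6)[unfolded B], of \<gamma> \<rho> u v]
    unfolding assms(9) M B .
  have s2: "(x - x\<^sub>0)\<^sup>2 + (y - y\<^sub>0)\<^sup>2 = s\<^sup>2" and \<Delta>2: "(x\<^sub>c - x\<^sub>0)\<^sup>2 + (y\<^sub>c - y\<^sub>0)\<^sup>2 = \<Delta>\<^sup>2"
    by (simp_all add: assms(12,13))
  have \<Delta>0: "0 \<le> \<Delta>" by (simp add: assms(13))
  have VP: "V\<^sub>P = \<gamma> * M * z\<^sub>0 / (z\<^sub>0\<^sup>2 + s\<^sup>2) powr (3/2)"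
    unfolding assms(10) V s2 ..
  have VC: "V\<^sub>C = \<gamma> * M * z\<^sub>0 / (z\<^sub>0\<^sup>2 + \<Delta>\<^sup>2) powr (3/2)"
    unfolding assms(11) V \<Delta>2 ..
  have pos: "z\<^sub>0\<^sup>2 + t\<^sup>2 > 0" for t
    using z0 by (simp add: add_pos_nonneg)
  have maximum: "V x' y' < V x\<^sub>0 y\<^sub>0" if "(x', y') \<noteq> (x\<^sub>0, y\<^sub>0)" for x' y'
  proof -
    have "(x' - x\<^sub>0)\<^sup>2 + (y' - y\<^sub>0)\<^sup>2 > 0"
      using that by (simp add: sum_power2_gt_zero_iff)
    then have "(z\<^sub>0\<^sup>2) powr (3/2) < (z\<^sub>0\<^sup>2 + ((x' - x\<^sub>0)\<^sup>2 + (y' - y\<^sub>0)\<^sup>2)) powr (3/2)"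
      by (intro powr_less_mono2) auto
    then have "\<gamma> * M * z\<^sub>0 / (z\<^sub>0\<^sup>2 + ((x' - x\<^sub>0)\<^sup>2 + (y' - y\<^sub>0)\<^sup>2)) powr (3/2)
        < \<gamma> * M * z\<^sub>0 / (z\<^sub>0\<^sup>2) powr (3/2)"
    proof (rule divide_strict_left_mono)
      have "(z\<^sub>0\<^sup>2) powr (3/2) > 0" using z0 by simp
      with \<open>(z\<^sub>0\<^sup>2) powr (3/2) < _\<close>
      show "0 < (z\<^sub>0\<^sup>2 + ((x' - x\<^sub>0)\<^sup>2 + (y' - y\<^sub>0)\<^sup>2)) powr (3/2) * (z\<^sub>0\<^sup>2) powr (3/2)"
        by (intro mult_pos_pos) linarith+
    qed (use \<gamma> M0 z0 in simp)
    then show ?thesis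
      by (simp add: V)
  qed
  have ratio: "V\<^sub>P / V\<^sub>C = ((z\<^sub>0\<^sup>2 + \<Delta>\<^sup>2) / (z\<^sub>0\<^sup>2 + s\<^sup>2)) powr (3/2)"
    unfolding VP VC using \<gamma> M0 z0 pos[of s] pos[of \<Delta>] by (simp add: powr_divide)
  have \<nu>: "\<nu> powr (2/3) = (z\<^sub>0\<^sup>2 + \<Delta>\<^sup>2) / (z\<^sub>0\<^sup>2 + s\<^sup>2)"
    unfolding assms(15) ratio using pos[of s] pos[of \<Delta>] by (simp add: powr_powr)
  have depth: "z\<^sub>0 = \<mu> * s"
    unfolding assms(16,17) \<nu> using depth_from_intensity_ratio[OF z0 \<Delta>0 assms(14)] by simp
  have mass: "M = 1 / \<gamma> * ((z\<^sub>0\<^sup>2 + \<Delta>\<^sup>2) powr (3/2) / z\<^sub>0) * V\<^sub>C"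
    unfolding VC using \<gamma> z0 pos[of \<Delta>] by simp
  have mass_P: "M = 1 / \<gamma> * ((z\<^sub>0\<^sup>2 + s\<^sup>2) powr (3/2) / z\<^sub>0) * V\<^sub>P"
    unfolding VP using \<gamma> z0 pos[of s] by simp
  have at_Q: "(x\<^sub>c, y\<^sub>c) = (x\<^sub>0, y\<^sub>0)" if "\<Delta> = 0"
    using \<Delta>2 that by (simp add: sum_power2_eq_zero_iff)
  have "let \<nu>\<^sub>Q = V\<^sub>P / V x\<^sub>0 y\<^sub>0; \<mu>\<^sub>Q = sqrt (\<nu>\<^sub>Q powr (2/3) / (1 - \<nu>\<^sub>Q powr (2/3)))
      in z\<^sub>0 = \<mu>\<^sub>Q * s \<and> M = 1 / \<gamma> * ((z\<^sub>0\<^sup>2 + s\<^sup>2) powr (3/2) / z\<^sub>0) * V\<^sub>P" if "\<Delta> = 0"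
  proof -
    have "V\<^sub>P / V x\<^sub>0 y\<^sub>0 = \<nu>"
      using at_Q[OF that] assms(11,15) by simp
    then show ?thesis
      using depth mass_P that unfolding Let_def assms(16,17) by simp
  qed
  with maximum depth mass at_Q show ?thesis
    by (intro conjI allI impI)
qed

end
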